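(* Let $P$ be a finite $\Gamma$-colored poset. Then $P$ is a $\Gamma$-colored $d$-complete poset if and only if it is a dominant minuscule heap.
   Context: Setup. $\Gamma$ is a finite set, whose elements are called colors, with fixed integers $\theta_{ab}$ ($a,b\in\Gamma$) such that $\theta_{aa}=2$; $\theta_{ab}\le 0$ for $a\ne b$; and $\theta_{ab}=0$ iff $\theta_{ba}=0$. Such data is a Dynkin diagram; it is also viewed as a graph with an edge between distinct $a,b$ exactly when $\theta_{ab}<0$, and it is acyclic if this simple graph is acyclic. Distinct $a,b$ are distant if $\theta_{ab}=0$ and adjacent ($a\sim b$) if $\theta_{ab}<0$; $a$ is $k$-adjacent to $b$ if $\theta_{ab}=-k$. $x\to y$ means $x$ is covered by $y$; $x,y$ are neighbors if $x\to y$ or $y\to x$. A $\Gamma$-colored poset is a locally finite poset $P$ with a surjective map $\kappa:P\to\Gamma$; $P_a:=\kappa^{-1}(a)$. Elements $x<y$ are consecutive elements of the color $a$ if $x,y\in P_a$ and the open interval $(x,y)$ contains no element of color $a$. $U(x,P):=\{y\in P : y>x,\ \kappa(y)\sim\kappa(x)\}$. A $\Gamma$-colored poset is $\Gamma$-colored $d$-complete if: (EC) elements with equal colors are comparable; (NA) neighbors have adjacent colors; (AC) elements with adjacent colors are comparable; (ICE2) for every $a\in\Gamma$, if $x<y$ are consecutive elements of the color $a$, then $\sum_{z\in(x,y)}-\theta_{\kappa(z),a}=2$; (UCB1) for every $a\in\Gamma$, if $x$ is maximal in $P_a$, then $U(x,P)$ is finite and $\sum_{y\in U(x,P)}-\theta_{\kappa(y),a}\le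 1$. A dominant minuscule heap is a finite $\Gamma$-colored poset such that: (S1) all neighbors have colors that are equal or adjacent, and the colors of incomparable elements are distant; (S2) for every $a\in\Gamma$, the open interval between any two consecutive elements of color $a$ contains either (i) exactly two elements whose colors are adjacent to $a$, and their colors are 1-adjacent to $a$, or (ii) exactly one element, and its color is 2-adjacent to $a$; (S3) for every $a\in\Gamma$, an element that is maximal in $P_a$ is covered by at most one element, and this element is maximal among all elements of some color that is 1-adjacent to $a$; (S4) $\Gamma$ is acyclic. *)

theory Defs
  imports Main
begin

locale dynkin_diagram =
  fixes \<Gamma> :: "'c set" and \<theta> :: "'c \<Rightarrow> 'c \<Rightarrow> int"
  assumes finite_colors: "finite \<Gamma>"
    and theta_diag: "a \<in> \<Gamma> \<Longrightarrow> \<theta> a a = 2"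
    and theta_nonpos: "a \<in> \<Gamma> \<Longrightarrow> b \<in> \<Gamma> \<Longrightarrow> a \<noteq> b \<Longrightarrow> \<theta> a b \<le> 0"
    and theta_zero_iff: "a \<in> \<Gamma> \<Longrightarrow> b \<in> \<Gamma> \<Longrightarrow> \<theta> a b = 0 \<longleftrightarrow> \<theta> b a = 0"
begin

definition distant :: "'c \<Rightarrow> 'c \<Rightarrow> bool" where
  "distant a b \<longleftrightarrow> a \<noteq> b \<and> \<theta> a b = 0"

definition adjacent :: "'c \<Rightarrow> 'c \<Rightarrow> bool" (infix "\<sim>" 50) where
  "a \<sim> b \<longleftrightarrow> a \<noteq> b \<and> \<theta> a b < 0"

text \<open>This relation is directed: \<open>k_adjacent k a b\<close> says that \<open>a\<close> is \<open>k\<close>-adjacent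
  to \<open>b\<close>, which constrains \<open>\<theta> a b\<close> and not \<open>\<theta> b a\<close>.\<close>

definition k_adjacent :: "nat \<Rightarrow> 'c \<Rightarrow> 'c \<Rightarrow> bool" where
  "k_adjacent k a b \<longleftrightarrow> a \<sim> b \<and> \<theta> a b = - int k"

text \<open>A cycle of the simple graph is a list of at least three distinct colors, read
  cyclically.\<close>

definition color_cycle :: "'c list \<Rightarrow> bool" where
  "color_cycle cs \<longleftrightarrow> set cs \<subseteq> \<Gamma> \<and> distinct cs \<and> 3 \<le> length cs \<and>
     (\<forall>i. Suc i < length cs \<longrightarrow> cs ! i \<sim> cs ! Suc i) \<and> last cs \<sim> hd cs"

definition acyclic_diagram :: bool where
  "acyclic_diagram \<longleftrightarrow> (\<nexists>cs. color_cycle cs)"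

end

text \<open>The poset is the carrier \<open>P\<close> ordered by the relation \<open>r\<close>, where \<open>(x, y) \<in> r\<close> means
  \<open>x \<le> y\<close>.\<close>

locale colored_poset = dynkin_diagram \<Gamma> \<theta>
  for \<Gamma> :: "'c set" and \<theta> :: "'c \<Rightarrow> 'c \<Rightarrow> int" +
  fixes P :: "'p set" and r :: "'p rel" and \<kappa> :: "'p \<Rightarrow> 'c"
  assumes partial_order: "partial_order_on P r"
    and locally_finite:
      "x \<in> P \<Longrightarrow> y \<in> P \<Longrightarrow> finite {z \<in> P. (x, z) \<in> r \<and> (z, y) \<in> r}"
    and surj_color: "\<kappa> ` P = \<Gamma>"
begin

definition less :: "'p \<Rightarrow> 'p \<Rightarrow> bool" (infix "\<prec>" 50) where
  "x \<prec> y \<longleftrightarrow> x \<in> P \<and> y \<in> P \<and> (x, y) \<in> r \<and> x \<noteq> y"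

definition comparable :: "'p \<Rightarrow> 'p \<Rightarrow> bool" where
  "comparable x y \<longleftrightarrow> (x, y) \<in> r \<or> (y, x) \<in> r"

definition open_interval :: "'p \<Rightarrow> 'p \<Rightarrow> 'p set" where
  "open_interval x y = {z \<in> P. x \<prec> z \<and> z \<prec> y}"

definition covered_by :: "'p \<Rightarrow> 'p \<Rightarrow> bool" where
  "covered_by x y \<longleftrightarrow> x \<prec> y \<and> open_interval x y = {}"

definition neighbors :: "'p \<Rightarrow> 'p \<Rightarrow> bool" where
  "neighbors x y \<longleftrightarrow> covered_by x y \<or> covered_by y x"

definition color_class :: "'c \<Rightarrow> 'p set" where
  "color_class a = {x \<in> P. \<kappa> x = a}"

definition consecutive :: "'c \<Rightarrow> 'p \<Rightarrow> 'p \<Rightarrow> bool" where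
  "consecutive a x y \<longleftrightarrow> x \<in> color_class a \<and> y \<in> color_class a \<and> x \<prec> y \<and>
     open_interval x y \<inter> color_class a = {}"

definition maximal_of_color :: "'c \<Rightarrow> 'p \<Rightarrow> bool" where
  "maximal_of_color a x \<longleftrightarrow> x \<in> color_class a \<and> (\<forall>y \<in> color_class a. \<not> x \<prec> y)"

definition upper_adjacent :: "'p \<Rightarrow> 'p set" where
  "upper_adjacent x = {y \<in> P. x \<prec> y \<and> \<kappa> y \<sim> \<kappa> x}"

end

locale colored_d_complete = colored_poset \<Gamma> \<theta> P r \<kappa>
  for \<Gamma> :: "'c set" and \<theta> :: "'c \<Rightarrow> 'c \<Rightarrow> int"
    and P :: "'p set" and r :: "'p rel" and \<kappa> :: "'p \<Rightarrow> 'c" +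
  assumes EC: "x \<in> P \<Longrightarrow> y \<in> P \<Longrightarrow> \<kappa> x = \<kappa> y \<Longrightarrow> comparable x y"
    and NA: "neighbors x y \<Longrightarrow> \<kappa> x \<sim> \<kappa> y"
    and AC: "x \<in> P \<Longrightarrow> y \<in> P \<Longrightarrow> \<kappa> x \<sim> \<kappa> y \<Longrightarrow> comparable x y"
    and ICE2: "a \<in> \<Gamma> \<Longrightarrow> consecutive a x y \<Longrightarrow>
      (\<Sum>z \<in> open_interval x y. - \<theta> (\<kappa> z) a) = 2"
    and UCB1: "a \<in> \<Gamma> \<Longrightarrow> maximal_of_color a x \<Longrightarrow>
      finite (upper_adjacent x) \<and> (\<Sum>y \<in> upper_adjacent x. - \<theta> (\<kappa> y) a) \<le> 1"

text \<open>In the second alternative of \<open>S2\<close> the interval itself is a singleton. Elements of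
  distant color are excluded from it, whereas the first alternative allows them.\<close>

locale dominant_minuscule_heap = colored_poset \<Gamma> \<theta> P r \<kappa>
  for \<Gamma> :: "'c set" and \<theta> :: "'c \<Rightarrow> 'c \<Rightarrow> int"
    and P :: "'p set" and r :: "'p rel" and \<kappa> :: "'p \<Rightarrow> 'c" +
  assumes finite_poset: "finite P"
    and S1_neighbors: "neighbors x y \<Longrightarrow> \<kappa> x = \<kappa> y \<or> \<kappa> x \<sim> \<kappa> y"
    and S1_incomparable:
      "x \<in> P \<Longrightarrow> y \<in> P \<Longrightarrow> \<not> comparable x y \<Longrightarrow> distant (\<kappa> x) (\<kappa> y)"
    and S2: "a \<in> \<Gamma> \<Longrightarrow> consecutive a x y \<Longrightarrow>
      (card {z \<in> open_interval x y. \<kappa> z \<sim> a} = 2 \<and>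
        (\<forall>z \<in> open_interval x y. \<kappa> z \<sim> a \<longrightarrow> k_adjacent 1 (\<kappa> z) a)) \<or>
      (\<exists>z. open_interval x y = {z} \<and> k_adjacent 2 (\<kappa> z) a)"
    and S3_unique: "a \<in> \<Gamma> \<Longrightarrow> maximal_of_color a x \<Longrightarrow>
      covered_by x y \<Longrightarrow> covered_by x y' \<Longrightarrow> y = y'"
    and S3_maximal: "a \<in> \<Gamma> \<Longrightarrow> maximal_of_color a x \<Longrightarrow> covered_by x y \<Longrightarrow>
      \<exists>b \<in> \<Gamma>. k_adjacent 1 b a \<and> maximal_of_color b y"
    and S4: "acyclic_diagram"

end

theory Submission
  imports Defs
begin

text \<open>Only \<open>S4\<close> and \<open>UCB1\<close> need more than a local count of weights.
  If the colors had a cycle, a minimal element among the maximal elements of its colors would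
  lie below its two cyclic neighbors, against \<open>UCB1\<close>. Conversely, in a heap \<open>S3\<close> makes the
  part of \<open>P\<close> above an element \<open>x\<close> maximal in its color a chain of elements, each maximal
  of its own color; the colors along this chain are distinct and successively adjacent. An
  element of adjacent color above the cover of \<open>x\<close> would close up a cycle of colors.\<close>

section \<open>Symmetry of adjacency and neighbors inside a cycle of colors\<close>

context dynkin_diagram
begin

lemma adjacent_sym:
  assumes "a \<in> \<Gamma>" "b \<in> \<Gamma>" "a \<sim> b"
  shows "b \<sim> a"
proof -
  have "\<theta> b a \<noteq> 0" using assms theta_zero_iff[of a b] by (auto simp: adjacent_def)
  then show ?thesis using assms theta_nonpos[of b a] by (auto simp: adjacent_def)
qed

lemma distant_or_adjacent:
  assumes "a \<in> \<Gamma>" "b \<in> \<Gamma>" "a \<noteq> b"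
  shows "distant a b \<or> a \<sim> b"
  using assms theta_nonpos[of a b] by (auto simp: adjacent_def distant_def)

text \<open>Used to refute cycles: two distinct adjacent colors at one place of the cycle will give
  a sum of weights that \<open>UCB1\<close> forbids.\<close>

lemma cycle_two_neighbors:
  assumes "color_cycle cs" "c \<in> set cs"
  obtains a b where "a \<in> set cs" "b \<in> set cs" "a \<noteq> b" "a \<sim> c" "b \<sim> c"
proof -
  have sub: "set cs \<subseteq> \<Gamma>" and dist: "distinct cs" and len: "3 \<le> length cs"
    and step: "\<And>i. Suc i < length cs \<Longrightarrow> cs ! i \<sim> cs ! Suc i"
    and close: "last cs \<sim> hd cs"
    using assms(1) by (auto simp: color_cycle_def)
  let ?n = "length cs"
  have ne: "cs \<noteq> []" using len by auto
  have close': "cs ! (?n - 1) \<sim> cs ! 0"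
    using close ne by (simp add: hd_conv_nth last_conv_nth)
  have sym: "cs ! j \<sim> cs ! i" if "cs ! i \<sim> cs ! j" "i < ?n" "j < ?n" for i j
    using that sub adjacent_sym nth_mem by blast
  obtain i where i: "i < ?n" "c = cs ! i" using assms(2) by (metis in_set_conv_nth)
  \<comment> \<open>\<open>p\<close> and \<open>s\<close> are the cyclic predecessor and successor
    of the index \<open>i\<close>. They differ because the cycle has length at least 3; in length 2
    they would coincide.\<close>
  define p where "p = (if i = 0 then ?n - 1 else i - 1)"
  define s where "s = (if i = ?n - 1 then 0 else Suc i)"
  have ps: "p < ?n" "s < ?n" "p \<noteq> s" using i(1) len by (auto simp: p_def s_def)
  have "cs ! p \<sim> c" using step[of "i - 1"] close' i by (auto simp: p_def)
  moreover have "c \<sim> cs ! s" using step[of i] close' i by (auto simp: s_def)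
  then have "cs ! s \<sim> c" using sym[of i s] i ps by simp
  moreover have "cs ! p \<noteq> cs ! s" using ps dist by (simp add: nth_eq_iff_index_eq)
  ultimately show thesis using that ps nth_mem by blast
qed

end

section \<open>Covers, extremal elements and weights of intervals\<close>

context colored_poset
begin

lemma less_trans: "x \<prec> y \<Longrightarrow> y \<prec> z \<Longrightarrow> x \<prec> z"
  using partial_order unfolding less_def partial_order_on_def preorder_on_def
  by (metis antisymD transD)

lemma less_irrefl: "\<not> x \<prec> x"
  by (simp add: less_def)

lemma comparable_less:
  "x \<in> P \<Longrightarrow> y \<in> P \<Longrightarrow> comparable x y \<Longrightarrow> x \<noteq> y \<Longrightarrow> x \<prec> y \<or> y \<prec> x"
  by (auto simp: less_def comparable_def)

lemma color_in: "x \<in> P \<Longrightarrow> \<kappa> x \<in> \<Gamma>"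
  using surj_color by blast

lemma finite_open_interval: "finite (open_interval x y)"
proof (cases "x \<in> P \<and> y \<in> P")
  case True
  then show ?thesis
    by (intro finite_subset[OF _ locally_finite[of x y]]) (auto simp: open_interval_def less_def)
next
  case False
  then have "open_interval x y = {}" by (auto simp: open_interval_def less_def)
  then show ?thesis by simp
qed

text \<open>Local finiteness supplies the measure. If \<open>z\<close> does not cover
  \<open>x\<close>, replace \<open>z\<close> by some \<open>w\<close> strictly between; the interval
  shrinks because \<open>w\<close> drops out of it.\<close>

lemma obtain_upper_cover:
  assumes "x \<prec> z"
  obtains y where "covered_by x y" "y = z \<or> y \<prec> z"
proof -
  have "\<exists>y. covered_by x y \<and> (y = z \<or> y \<prec> z)" using assms
  proof (induction "card (open_interval x z)" arbitrary: z rule: less_induct)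
    case less
    show ?case
    proof (cases "open_interval x z = {}")
      case True
      then show ?thesis using less.prems by (auto simp: covered_by_def)
    next
      case False
      then obtain w where w: "x \<prec> w" "w \<prec> z" by (auto simp: open_interval_def)
      moreover from this have "w \<in> P" by (simp add: less_def)
      ultimately have "open_interval x w \<subset> open_interval x z"
        using less_irrefl less_trans unfolding open_interval_def by blast
      then have "card (open_interval x w) < card (open_interval x z)"
        using finite_open_interval psubset_card_mono by blast
      with less.hyps w show ?thesis using less_trans by blast
    qed
  qed
  then show thesis using that by blast
qed

lemma obtain_lower_cover:
  assumes "x \<prec> z"
  obtains y where "covered_by y z" "y = x \<or> x \<prec> y"
proof -
  have "\<exists>y. covered_by y z \<and> (y = x \<or> x \<prec> y)" using assms
  proof (induction "card (open_interval x z)" arbitrary: x rule: less_induct)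
    case less
    show ?case
    proof (cases "open_interval x z = {}")
      case True
      then show ?thesis using less.prems by (auto simp: covered_by_def)
    next
      case False
      then obtain w where w: "x \<prec> w" "w \<prec> z" by (auto simp: open_interval_def)
      moreover from this have "w \<in> P" by (simp add: less_def)
      ultimately have "open_interval w z \<subset> open_interval x z"
        using less_irrefl less_trans unfolding open_interval_def by blast
      then have "card (open_interval w z) < card (open_interval x z)"
        using finite_open_interval psubset_card_mono by blast
      with less.hyps w show ?thesis using less_trans by blast
    qed
  qed
  then show thesis using that by blast
qed

lemma asymp_on_less: "asymp_on A (\<prec>)"
  using less_trans less_irrefl by (blast intro: asymp_onI)

lemma transp_on_less: "transp_on A (\<prec>)"
  using less_trans by (blast intro: transp_onI)

lemma finite_has_minimal_less:
  assumes "finite A" "A \<noteq> {}"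
  obtains m where "m \<in> A" "\<And>y. y \<in> A \<Longrightarrow> \<not> y \<prec> m"
  using Finite_Set.bex_min_element[OF assms(1) asymp_on_less transp_on_less assms(2)]
    less_irrefl by metis

lemma finite_has_maximal_less:
  assumes "finite A" "A \<noteq> {}"
  obtains m where "m \<in> A" "\<And>y. y \<in> A \<Longrightarrow> \<not> m \<prec> y"
  using Finite_Set.bex_max_element[OF assms(1) asymp_on_less transp_on_less assms(2)]
    less_irrefl by metis

lemma maximal_of_color_exists:
  assumes "finite P" "a \<in> \<Gamma>"
  obtains x where "maximal_of_color a x"
proof -
  have "finite (color_class a)" "color_class a \<noteq> {}"
    using assms surj_color by (auto simp: color_class_def)
  then obtain x where "x \<in> color_class a" "\<And>y. y \<in> color_class a \<Longrightarrow> \<not> x \<prec> y"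
    by (rule finite_has_maximal_less) blast
  then show thesis using that by (auto simp: maximal_of_color_def)
qed

text \<open>Between consecutive elements no color equals \<open>a\<close>, so the diagonal value 2
  of \<open>\<theta>\<close> never enters. Every other color that is not adjacent to
  \<open>a\<close> is distant from it and has weight 0.\<close>

lemma sum_consecutive:
  assumes "a \<in> \<Gamma>" "consecutive a x y"
  shows "(\<Sum>z \<in> open_interval x y. - \<theta> (\<kappa> z) a)
    = (\<Sum>z \<in> {z \<in> open_interval x y. \<kappa> z \<sim> a}. - \<theta> (\<kappa> z) a)"
proof (rule sum.mono_neutral_right)
  show "finite (open_interval x y)" by (rule finite_open_interval)
  show "\<forall>z \<in> open_interval x y - {z \<in> open_interval x y. \<kappa> z \<sim> a}. - \<theta> (\<kappa> z) a = 0"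
  proof
    fix z assume z: "z \<in> open_interval x y - {z \<in> open_interval x y. \<kappa> z \<sim> a}"
    then have "z \<in> P" by (simp add: open_interval_def)
    moreover have "\<kappa> z \<noteq> a"
      using z assms(2) by (auto simp: consecutive_def color_class_def open_interval_def)
    ultimately have "distant (\<kappa> z) a"
      using z assms(1) distant_or_adjacent color_in by blast
    then show "- \<theta> (\<kappa> z) a = 0" by (simp add: distant_def)
  qed
qed auto

end

section \<open>From the d-complete axioms to the heap axioms\<close>

context colored_d_complete
begin

text \<open>\<open>ICE2\<close> does not see elements of distant color, yet the second alternative
  of \<open>S2\<close> excludes them. \<open>NA\<close> closes the gap: every maximal chain of the
  interval starts and ends with a color adjacent to \<open>a\<close>, hence with
  \<open>z\<close>.\<close>

lemma consecutive_singleton: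
  assumes "consecutive a x y" "{w \<in> open_interval x y. \<kappa> w \<sim> a} = {z}"
  shows "open_interval x y = {z}"
proof -
  have xy: "x \<in> P" "y \<in> P" "\<kappa> x = a" "\<kappa> y = a" "x \<prec> y"
    using assms(1) by (auto simp: consecutive_def color_class_def)
  have zI: "z \<in> open_interval x y" using assms(2) by blast
  have "w = z" if w: "w \<in> open_interval x y" for w
  proof -
    have xw: "x \<prec> w" and wy: "w \<prec> y" and wP: "w \<in> P" using w by (auto simp: open_interval_def)
    \<comment> \<open>Any \<open>w\<close> in the interval is squeezed between a cover
      \<open>u\<close> of \<open>x\<close> and an element \<open>v\<close> covered by
      \<open>y\<close>. Both have colors adjacent to \<open>a\<close>, so both equal
      \<open>z\<close>.\<close>
    obtain u where u: "covered_by x u" "u = w \<or> u \<prec> w" using obtain_upper_cover[OF xw] .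
    obtain v where v: "covered_by v y" "v = w \<or> w \<prec> v" using obtain_lower_cover[OF wy] .
    have "\<kappa> x \<sim> \<kappa> u" using NA[of x u] u by (simp add: neighbors_def)
    moreover have "\<kappa> v \<sim> \<kappa> y" using NA[of v y] v by (simp add: neighbors_def)
    moreover have "x \<prec> u" "u \<prec> y" "x \<prec> v" "v \<prec> y"
      using u v xw wy less_trans unfolding covered_by_def by blast+
    moreover from this have "u \<in> P" "v \<in> P" by (simp_all add: less_def)
    ultimately have "u \<in> {w \<in> open_interval x y. \<kappa> w \<sim> a}" "v \<in> {w \<in> open_interval x y. \<kappa> w \<sim> a}"
      using xy adjacent_sym[of a "\<kappa> u"] color_in[of x] color_in[of u]
      by (auto simp: open_interval_def)
    then have "u = z" "v = z" using assms(2) by auto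
    then show ?thesis using u(2) v(2) less_trans less_irrefl by blast
  qed
  then show ?thesis using zI by blast
qed

text \<open>Weights of adjacent colors are integers that are at least 1, so the total 2 of
  \<open>ICE2\<close> can only arise as 2 or as 1 + 1.\<close>

lemma interval_dichotomy:
  assumes a: "a \<in> \<Gamma>" and c: "consecutive a x y"
  shows "(card {z \<in> open_interval x y. \<kappa> z \<sim> a} = 2 \<and>
        (\<forall>z \<in> open_interval x y. \<kappa> z \<sim> a \<longrightarrow> k_adjacent 1 (\<kappa> z) a)) \<or>
      (\<exists>z. open_interval x y = {z} \<and> k_adjacent 2 (\<kappa> z) a)"
proof -
  define A where "A = {z \<in> open_interval x y. \<kappa> z \<sim> a}"
  have fin: "finite A" using finite_open_interval by (simp add: A_def)
  have sum2: "(\<Sum>z \<in> A. - \<theta> (\<kappa> z) a) = 2"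
    using ICE2[OF a c] sum_consecutive[OF a c] by (simp add: A_def)
  have ge1: "- \<theta> (\<kappa> z) a \<ge> 1" if "z \<in> A" for z
    using that by (simp add: A_def adjacent_def)
  have "int (card A) \<le> (\<Sum>z \<in> A. - \<theta> (\<kappa> z) a)"
    using sum_mono[of A "\<lambda>_. 1" "\<lambda>z. - \<theta> (\<kappa> z) a"] ge1 by simp
  then have "card A \<le> 2" using sum2 by simp
  moreover have "card A \<noteq> 0" using sum2 fin by auto
  ultimately consider "card A = 1" | "card A = 2" by linarith
  then show ?thesis
  proof cases
    case 1
    then obtain z where z: "A = {z}" using card_1_singletonE by blast
    then have "open_interval x y = {z}"
      using consecutive_singleton[OF c] by (simp add: A_def)
    moreover have "z \<in> A" "\<theta> (\<kappa> z) a = - 2" using sum2 z by auto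
    ultimately show ?thesis by (auto simp: A_def k_adjacent_def)
  next
    case 2
    then obtain u v where uv: "A = {u, v}" "u \<noteq> v" by (meson card_2_iff)
    then have "\<theta> (\<kappa> u) a = - 1 \<and> \<theta> (\<kappa> v) a = - 1"
      using sum2 ge1[of u] ge1[of v] by simp
    then have "\<forall>z \<in> A. k_adjacent 1 (\<kappa> z) a"
      using uv by (auto simp: A_def k_adjacent_def)
    then show ?thesis using 2 by (auto simp: A_def)
  qed
qed

text \<open>Each summand in \<open>UCB1\<close> is at least 1 and the sum is at most 1, so one
  element already exhausts the bound.\<close>

lemma maximal_upper_adjacent_unique:
  assumes a: "a \<in> \<Gamma>" and m: "maximal_of_color a x"
    and y: "y \<in> upper_adjacent x"
  shows "upper_adjacent x = {y}" "\<theta> (\<kappa> y) a = - 1"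
proof -
  have xa: "\<kappa> x = a" using m by (simp add: maximal_of_color_def color_class_def)
  have fin: "finite (upper_adjacent x)"
    and le1: "(\<Sum>y \<in> upper_adjacent x. - \<theta> (\<kappa> y) a) \<le> 1"
    using UCB1[OF a m] by auto
  have ge1: "- \<theta> (\<kappa> z) a \<ge> 1" if "z \<in> upper_adjacent x" for z
    using that xa by (simp add: upper_adjacent_def adjacent_def)
  have "int (card (upper_adjacent x)) \<le> (\<Sum>z \<in> upper_adjacent x. - \<theta> (\<kappa> z) a)"
    using sum_mono[of "upper_adjacent x" "\<lambda>_. 1" "\<lambda>z. - \<theta> (\<kappa> z) a"] ge1 by simp
  then have "card (upper_adjacent x) \<le> 1" using le1 by simp
  then show U: "upper_adjacent x = {y}"
    using y fin by (auto simp: card_le_Suc0_iff_eq)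
  show "\<theta> (\<kappa> y) a = - 1" using le1 ge1[OF y] U by simp
qed

lemma cover_upper_adjacent:
  assumes "covered_by x y"
  shows "y \<in> upper_adjacent x"
proof -
  have "x \<in> P" "y \<in> P" "x \<prec> y" using assms by (auto simp: covered_by_def less_def)
  moreover have "\<kappa> x \<sim> \<kappa> y" using NA[of x y] assms by (simp add: neighbors_def)
  ultimately show ?thesis using adjacent_sym color_in by (simp add: upper_adjacent_def)
qed

text \<open>An element above \<open>y\<close> with the color of \<open>y\<close> would be a second
  member of \<open>upper_adjacent x\<close>, which uniqueness excludes.\<close>

lemma cover_maximal:
  assumes a: "a \<in> \<Gamma>" and m: "maximal_of_color a x" and c: "covered_by x y"
  shows "\<exists>b \<in> \<Gamma>. k_adjacent 1 b a \<and> maximal_of_color b y"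
proof (intro bexI conjI)
  have y: "y \<in> upper_adjacent x" using c by (rule cover_upper_adjacent)
  have xa: "\<kappa> x = a" using m by (simp add: maximal_of_color_def color_class_def)
  have xy: "y \<in> P" "x \<prec> y" "\<kappa> y \<sim> a" using y xa by (auto simp: upper_adjacent_def)
  show "\<kappa> y \<in> \<Gamma>" using xy color_in by simp
  show "k_adjacent 1 (\<kappa> y) a"
    using xy maximal_upper_adjacent_unique(2)[OF a m y] by (simp add: k_adjacent_def)
  have "\<not> y \<prec> z" if "z \<in> color_class (\<kappa> y)" for z
  proof
    assume yz: "y \<prec> z"
    then have "z \<in> upper_adjacent x"
      using that xy xa less_trans by (auto simp: upper_adjacent_def color_class_def)
    then show False
      using maximal_upper_adjacent_unique(1)[OF a m y] yz less_irrefl by auto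
  qed
  then show "maximal_of_color (\<kappa> y) y"
    using xy by (simp add: maximal_of_color_def color_class_def)
qed

lemma acyclic:
  assumes "finite P"
  shows acyclic_diagram
  unfolding acyclic_diagram_def
proof
  assume "\<exists>cs. color_cycle cs"
  then obtain cs where cs: "color_cycle cs" by blast
  then have sub: "set cs \<subseteq> \<Gamma>" and ne: "set cs \<noteq> {}" by (auto simp: color_cycle_def)
  have "\<forall>a\<in>\<Gamma>. \<exists>x. maximal_of_color a x"
    using maximal_of_color_exists[OF assms] by blast
  then obtain top where top: "\<And>a. a \<in> \<Gamma> \<Longrightarrow> maximal_of_color a (top a)"
    by (meson bchoice)
  have topP: "top a \<in> P" "\<kappa> (top a) = a" if "a \<in> set cs" for a
    using top[of a] that sub by (auto simp: maximal_of_color_def color_class_def)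
  \<comment> \<open>Minimality is taken only among the chosen top elements of the colors on the
    cycle, so it can later decide the direction of a comparison with another such top.\<close>
  obtain m where "m \<in> top ` set cs" and min: "\<And>y. y \<in> top ` set cs \<Longrightarrow> \<not> y \<prec> m"
    using finite_has_minimal_less[of "top ` set cs"] ne by auto
  then obtain c where c: "c \<in> set cs" "m = top c" by blast
  obtain a b where ab: "a \<in> set cs" "b \<in> set cs" "a \<noteq> b" "a \<sim> c" "b \<sim> c"
    using cycle_two_neighbors[OF cs c(1)] .
  have up: "top d \<in> upper_adjacent m" if d: "d \<in> set cs" "d \<sim> c" for d
  proof -
    \<comment> \<open>\<open>AC\<close> makes the two tops comparable, and minimality of
      \<open>m\<close> rules out \<open>top d\<close> lying below it.\<close>
    have "comparable (top d) m" using AC topP c d by simp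
    moreover have "top d \<noteq> m" using topP(2)[of c] topP(2)[of d] c d by (auto simp: adjacent_def)
    ultimately have "m \<prec> top d" using comparable_less topP c d min by blast
    then show ?thesis using topP c d by (simp add: upper_adjacent_def)
  qed
  have "maximal_of_color c m" "c \<in> \<Gamma>" using top c sub by auto
  then have "top a = top b"
    using maximal_upper_adjacent_unique(1) up ab by (metis singletonD)
  then show False using topP ab by metis
qed

end

section \<open>From the heap axioms to the d-complete axioms\<close>

context dominant_minuscule_heap
begin

text \<open>A cover between equal colors would be a consecutive pair with empty interval, but both
  alternatives of \<open>S2\<close> require an element in between.\<close>

lemma neighbors_adjacent:
  assumes "neighbors x y"
  shows "\<kappa> x \<sim> \<kappa> y"
proof -
  have "\<kappa> u \<noteq> \<kappa> v" if c: "covered_by u v" for u v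
  proof
    assume eq: "\<kappa> u = \<kappa> v"
    have u: "u \<in> P" "v \<in> P" "u \<prec> v" "open_interval u v = {}"
      using c by (auto simp: covered_by_def less_def)
    then have "consecutive (\<kappa> u) u v" using eq by (simp add: consecutive_def color_class_def)
    then show False using S2[of "\<kappa> u" u v] u color_in by simp
  qed
  then have "\<kappa> x \<noteq> \<kappa> y" using assms by (metis neighbors_def)
  then show ?thesis using S1_neighbors assms by blast
qed

lemma interval_sum:
  assumes a: "a \<in> \<Gamma>" and c: "consecutive a x y"
  shows "(\<Sum>z \<in> open_interval x y. - \<theta> (\<kappa> z) a) = 2"
  using S2[OF a c]
proof
  assume A: "card {z \<in> open_interval x y. \<kappa> z \<sim> a} = 2 \<and>
        (\<forall>z \<in> open_interval x y. \<kappa> z \<sim> a \<longrightarrow> k_adjacent 1 (\<kappa> z) a)"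
  then have "(\<Sum>z \<in> {z \<in> open_interval x y. \<kappa> z \<sim> a}. - \<theta> (\<kappa> z) a)
      = (\<Sum>z \<in> {z \<in> open_interval x y. \<kappa> z \<sim> a}. 1)"
    by (intro sum.cong) (auto simp: k_adjacent_def)
  then show ?thesis using A sum_consecutive[OF a c] by simp
\<comment> \<open>In the remaining alternative the interval is a single element, whose weight is
  2.\<close>
qed (auto simp: k_adjacent_def)

text \<open>Climb from \<open>x\<close> towards \<open>z\<close> by covers.
  \<open>S3_maximal\<close> passes maximality in the own color to each cover, so the induction on
  the number of elements above continues.\<close>

lemma color_path_above_maximal:
  assumes "maximal_of_color (\<kappa> x) x" "x = z \<or> x \<prec> z"
  shows "\<exists>cs. cs \<noteq> [] \<and> hd cs = \<kappa> x \<and> last cs = \<kappa> z \<and> distinct cs \<and>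
    set cs \<subseteq> \<kappa> ` {w \<in> P. x = w \<or> x \<prec> w} \<and> successively (\<sim>) cs"
  using assms
proof (induction "card {w \<in> P. x \<prec> w}" arbitrary: x rule: less_induct)
  case less
  have xP: "x \<in> P" using less.prems(1) by (simp add: maximal_of_color_def color_class_def)
  show ?case
  proof (cases "x = z")
    case True
    then show ?thesis using xP by (intro exI[of _ "[\<kappa> x]"]) auto
  next
    case False
    with less.prems have "x \<prec> z" by blast
    then obtain y where y: "covered_by x y" "y = z \<or> y \<prec> z" by (rule obtain_upper_cover)
    then have xy: "x \<prec> y" "y \<in> P" by (auto simp: covered_by_def less_def)
    have my: "maximal_of_color (\<kappa> y) y"
      using S3_maximal[OF color_in[OF xP] less.prems(1) y(1)]
      by (auto simp: maximal_of_color_def color_class_def)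
    have "{w \<in> P. y \<prec> w} \<subset> {w \<in> P. x \<prec> w}"
      using xy less_trans less_irrefl by blast
    then have "card {w \<in> P. y \<prec> w} < card {w \<in> P. x \<prec> w}"
      using finite_poset by (intro psubset_card_mono) auto
    from less.hyps[OF this my y(2)] obtain cs where cs: "cs \<noteq> []" "hd cs = \<kappa> y"
      "last cs = \<kappa> z" "distinct cs" "set cs \<subseteq> \<kappa> ` {w \<in> P. y = w \<or> y \<prec> w}"
      "successively (\<sim>) cs" by blast
    \<comment> \<open>The colors collected so far belong to elements strictly above
      \<open>x\<close>, and \<open>x\<close> is maximal in its color; so \<open>\<kappa> x\<close>
      is new and the path stays distinct.\<close>
    have above: "set cs \<subseteq> \<kappa> ` {w \<in> P. x \<prec> w}" using cs(5) xy less_trans by blast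
    then have "\<kappa> x \<notin> set cs"
      using less.prems(1) by (fastforce simp: maximal_of_color_def color_class_def)
    moreover have "\<kappa> x \<sim> \<kappa> y" using neighbors_adjacent y(1) by (simp add: neighbors_def)
    ultimately show ?thesis
      using cs above xP by (intro exI[of _ "\<kappa> x # cs"]) (auto simp: successively_Cons)
  qed
qed

text \<open>If a cover \<open>y\<close> of \<open>x\<close> lay strictly below \<open>z\<close>, the
  color path from \<open>y\<close> to \<open>z\<close> together with \<open>\<kappa> x\<close> would
  close up to a cycle, against \<open>S4\<close>.\<close>

lemma upper_adjacent_covers:
  assumes m: "maximal_of_color (\<kappa> x) x" and z: "z \<in> upper_adjacent x"
  shows "covered_by x z"
proof (rule ccontr)
  assume not_cover: "\<not> covered_by x z"
  have xz: "x \<prec> z" "\<kappa> z \<sim> \<kappa> x" using z by (auto simp: upper_adjacent_def)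
  then have xP: "x \<in> P" and zP: "z \<in> P" by (auto simp: less_def)
  from xz(1) obtain y where y: "covered_by x y" "y = z \<or> y \<prec> z" by (rule obtain_upper_cover)
  then have yz: "y \<prec> z" using not_cover by blast
  have xy: "x \<prec> y" "y \<in> P" using y(1) by (auto simp: covered_by_def less_def)
  have my: "maximal_of_color (\<kappa> y) y"
    using S3_maximal[OF color_in[OF xP] m y(1)]
    by (auto simp: maximal_of_color_def color_class_def)
  obtain cs where cs: "cs \<noteq> []" "hd cs = \<kappa> y" "last cs = \<kappa> z" "distinct cs"
    "set cs \<subseteq> \<kappa> ` {w \<in> P. y = w \<or> y \<prec> w}" "successively (\<sim>) cs"
    using color_path_above_maximal[OF my y(2)] by blast
  \<comment> \<open>Distinct end colors give the path at least two entries, so that adding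
    \<open>\<kappa> x\<close> reaches the length 3 required of a cycle.\<close>
  have "\<kappa> y \<noteq> \<kappa> z" using my yz zP by (auto simp: maximal_of_color_def color_class_def)
  then have len: "2 \<le> length cs"
    using cs(1-3) by (cases cs rule: remdups_adj.cases) auto
  have above: "set cs \<subseteq> \<kappa> ` {w \<in> P. x \<prec> w}" using cs(5) xy less_trans by blast
  then have nx: "\<kappa> x \<notin> set cs"
    using m by (fastforce simp: maximal_of_color_def color_class_def)
  have "\<kappa> x \<sim> \<kappa> y" using neighbors_adjacent y(1) by (simp add: neighbors_def)
  then have "successively (\<sim>) (\<kappa> x # cs)" using cs by (simp add: successively_Cons)
  moreover have "set (\<kappa> x # cs) \<subseteq> \<Gamma>" using above xP surj_color by auto
  moreover have "distinct (\<kappa> x # cs)" "3 \<le> length (\<kappa> x # cs)"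
    "last (\<kappa> x # cs) \<sim> hd (\<kappa> x # cs)"
    using nx cs len xz by auto
  ultimately have "color_cycle (\<kappa> x # cs)"
    unfolding color_cycle_def successively_conv_nth by blast
  then show False using S4 by (auto simp: acyclic_diagram_def)
qed

text \<open>All members of \<open>upper_adjacent x\<close> are covers of \<open>x\<close>, so
  \<open>S3\<close> leaves at most one, of weight 1.\<close>

lemma upper_adjacent_sum:
  assumes a: "a \<in> \<Gamma>" and m: "maximal_of_color a x"
  shows "finite (upper_adjacent x) \<and> (\<Sum>y \<in> upper_adjacent x. - \<theta> (\<kappa> y) a) \<le> 1"
proof -
  have xa: "\<kappa> x = a" using m by (simp add: maximal_of_color_def color_class_def)
  show ?thesis
  proof (cases "upper_adjacent x = {}")
    case False
    then obtain y where y: "y \<in> upper_adjacent x" by blast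
    have cov: "covered_by x z" if "z \<in> upper_adjacent x" for z
      using upper_adjacent_covers m xa that by simp
    then have "upper_adjacent x = {y}" using S3_unique[OF a m] y by blast
    moreover have "\<theta> (\<kappa> y) a = - 1"
      using S3_maximal[OF a m cov[OF y]]
      by (auto simp: k_adjacent_def maximal_of_color_def color_class_def)
    ultimately show ?thesis by simp
  qed simp
qed

end

theorem theorem3p5:
  fixes \<Gamma> :: "'c set" and \<theta> :: "'c \<Rightarrow> 'c \<Rightarrow> int"
    and P :: "'p set" and r :: "'p rel" and \<kappa> :: "'p \<Rightarrow> 'c"
  assumes "colored_poset \<Gamma> \<theta> P r \<kappa>" and "finite P"
  shows "colored_d_complete \<Gamma> \<theta> P r \<kappa> \<longleftrightarrow> dominant_minuscule_heap \<Gamma> \<theta> P r \<kappa>"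
proof
  assume "colored_d_complete \<Gamma> \<theta> P r \<kappa>"
  then interpret colored_d_complete \<Gamma> \<theta> P r \<kappa> .
  show "dominant_minuscule_heap \<Gamma> \<theta> P r \<kappa>"
  proof
    show "finite P" by (fact assms(2))
    show "\<kappa> x = \<kappa> y \<or> \<kappa> x \<sim> \<kappa> y" if "neighbors x y" for x y
      using NA that by blast
    show "distant (\<kappa> x) (\<kappa> y)" if "x \<in> P" "y \<in> P" "\<not> comparable x y" for x y
      \<comment> \<open>Incomparability excludes equal colors by \<open>EC\<close> and adjacent ones
        by \<open>AC\<close>; only distant colors are left.\<close>
      using that EC AC distant_or_adjacent color_in by blast
    show "y = y'" if "a \<in> \<Gamma>" "maximal_of_color a x" "covered_by x y" "covered_by x y'"
      for a x y y'
      using that maximal_upper_adjacent_unique(1) cover_upper_adjacent by (metis singletonD)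
  qed (use interval_dichotomy cover_maximal acyclic assms(2) in blast)+
next
  assume "dominant_minuscule_heap \<Gamma> \<theta> P r \<kappa>"
  then interpret dominant_minuscule_heap \<Gamma> \<theta> P r \<kappa> .
  show "colored_d_complete \<Gamma> \<theta> P r \<kappa>"
  proof
    show "comparable x y" if "x \<in> P" "y \<in> P" "\<kappa> x = \<kappa> y" for x y
      \<comment> \<open>Distant colors are different by definition, so equal colors force
        comparability.\<close>
      using S1_incomparable that by (auto simp: distant_def)
    show "comparable x y" if "x \<in> P" "y \<in> P" "\<kappa> x \<sim> \<kappa> y" for x y
      using S1_incomparable[of x y] that by (auto simp: distant_def adjacent_def)
  qed (use neighbors_adjacent interval_sum upper_adjacent_sum in blast)+
qed

end
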